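(* Suppose that $A$ and $B$ are Banach algebras and $T:B\to A$ is an algebra homomorphism with $\|T\|\le 1$. Suppose that $\mathcal{C}$ is a Banach algebra and that $A$ and $B$ are injective as Banach left $\mathcal{C}$-modules. Then the $T$-Lau product algebra $A\times_T B$ is injective as a Banach left $\mathcal{C}$-module.
   Context: The $T$-Lau product algebra $A\times_T B$ is the Cartesian product $A\times B$ with multiplication $(a,b)\times_T(c,d)=(ac+T(b)c+aT(d),\,bd)$ and norm $\|(a,b)\|=\|a\|+\|b\|$; it is a Banach algebra. Convention on module structures: whenever $A\times_T B$ is a Banach left $\mathcal{C}$-module, $A$ and $B$ are taken to be Banach left $\mathcal{C}$-modules with the actions $c\cdot a=c\cdot(a,0)$ and $c\cdot b=c\cdot(0,b)$ for $c\in\mathcal{C}$, $a\in A$, $b\in B$. For Banach left $\mathcal{C}$-modules $E,F$, $B(E,F)$ is the space of bounded linear operators $E\to F$ and ${}_{\mathcal{C}}B(E,F)$ is the space of bounded left $\mathcal{C}$-module morphisms. An operator $S\in B(E,F)$ is admissible if there is $S'\in B(F,E)$ with $S\circ S'\circ S=S$. A Banach left $\mathcal{C}$-module $K$ is injective if for all Banach left $\mathcal{C}$-modules $E,F$ and every admissible monomorphism $S\in{}_{\mathcal{C}}B(E,F)$, the induced map ${}_{\mathcal{C}}B(F,K)\to{}_{\mathcal{C}}B(E,K)$, $R\mapsto R\circ S$, is surjective. *)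

theory Defs
  imports Complex_Main "HOL-Library.FuncSet" "HOL-Algebra.Module"
begin

(* Every complete or incomplete real_normed_field is isomorphic to the reals or to the complex
   numbers (its norm is multiplicative), so 'k ranges over the two usual scalar fields. *)
definition scalar_field :: "'k::real_normed_field ring" where
  "scalar_field = \<lparr>carrier = UNIV, mult = (*), one = 1, zero = 0, add = (+)\<rparr>"

(* Normed spaces and normed algebras share this record.  The fields mult and one are inherited from
   HOL-Algebra's module record: mult is constrained only by banach_algebra, one is never used
   (algebras are not assumed to be unital). *)
record ('k, 'v) normed_struct = "('k, 'v) module" +
  vnorm :: "'v \<Rightarrow> real"

locale banach_space = Module.module scalar_field V
  for V :: "('k::real_normed_field, 'v) normed_struct" (structure) +
  assumes vnorm_nonneg: "x \<in> carrier V \<Longrightarrow> 0 \<le> vnorm V x"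
    and vnorm_eq_zero: "x \<in> carrier V \<Longrightarrow> vnorm V x = 0 \<longleftrightarrow> x = \<zero>"
    and vnorm_smult: "x \<in> carrier V \<Longrightarrow> vnorm V (r \<odot> x) = norm r * vnorm V x"
    and vnorm_triangle: "x \<in> carrier V \<Longrightarrow> y \<in> carrier V \<Longrightarrow>
          vnorm V (x \<oplus> y) \<le> vnorm V x + vnorm V y"
    and complete: "(\<And>n::nat. s n \<in> carrier V) \<Longrightarrow>
          (\<And>e. e > 0 \<Longrightarrow> \<exists>N. \<forall>m\<ge>N. \<forall>n\<ge>N. vnorm V (s m \<ominus> s n) < e) \<Longrightarrow>
          \<exists>x\<in>carrier V. (\<lambda>n. vnorm V (s n \<ominus> x)) \<longlonglongrightarrow> 0"

locale banach_algebra = banach_space +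
  assumes mult_closed: "x \<in> carrier V \<Longrightarrow> y \<in> carrier V \<Longrightarrow> x \<otimes> y \<in> carrier V"
    and mult_assoc: "x \<in> carrier V \<Longrightarrow> y \<in> carrier V \<Longrightarrow> z \<in> carrier V \<Longrightarrow>
          (x \<otimes> y) \<otimes> z = x \<otimes> (y \<otimes> z)"
    and mult_add_left: "x \<in> carrier V \<Longrightarrow> y \<in> carrier V \<Longrightarrow> z \<in> carrier V \<Longrightarrow>
          (x \<oplus> y) \<otimes> z = x \<otimes> z \<oplus> y \<otimes> z"
    and mult_add_right: "x \<in> carrier V \<Longrightarrow> y \<in> carrier V \<Longrightarrow> z \<in> carrier V \<Longrightarrow>
          x \<otimes> (y \<oplus> z) = x \<otimes> y \<oplus> x \<otimes> z"
    and mult_smult_left: "x \<in> carrier V \<Longrightarrow> y \<in> carrier V \<Longrightarrow> (r \<odot> x) \<otimes> y = r \<odot> (x \<otimes> y)"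
    and mult_smult_right: "x \<in> carrier V \<Longrightarrow> y \<in> carrier V \<Longrightarrow> x \<otimes> (r \<odot> y) = r \<odot> (x \<otimes> y)"
    and vnorm_mult: "x \<in> carrier V \<Longrightarrow> y \<in> carrier V \<Longrightarrow>
          vnorm V (x \<otimes> y) \<le> vnorm V x * vnorm V y"

(* The action is required to be bounded, not necessarily contractive. *)
locale banach_left_module = C: banach_algebra C + E: banach_space E
  for C :: "('k::real_normed_field, 'c) normed_struct"
    and E :: "('k, 'v) normed_struct"
    and act :: "'c \<Rightarrow> 'v \<Rightarrow> 'v" +
  assumes act_closed: "c \<in> carrier C \<Longrightarrow> x \<in> carrier E \<Longrightarrow> act c x \<in> carrier E"
    and act_add_left: "c \<in> carrier C \<Longrightarrow> d \<in> carrier C \<Longrightarrow> x \<in> carrier E \<Longrightarrow>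
          act (c \<oplus>\<^bsub>C\<^esub> d) x = act c x \<oplus>\<^bsub>E\<^esub> act d x"
    and act_add_right: "c \<in> carrier C \<Longrightarrow> x \<in> carrier E \<Longrightarrow> y \<in> carrier E \<Longrightarrow>
          act c (x \<oplus>\<^bsub>E\<^esub> y) = act c x \<oplus>\<^bsub>E\<^esub> act c y"
    and act_smult_left: "c \<in> carrier C \<Longrightarrow> x \<in> carrier E \<Longrightarrow>
          act (r \<odot>\<^bsub>C\<^esub> c) x = r \<odot>\<^bsub>E\<^esub> act c x"
    and act_smult_right: "c \<in> carrier C \<Longrightarrow> x \<in> carrier E \<Longrightarrow>
          act c (r \<odot>\<^bsub>E\<^esub> x) = r \<odot>\<^bsub>E\<^esub> act c x"
    and act_mult: "c \<in> carrier C \<Longrightarrow> d \<in> carrier C \<Longrightarrow> x \<in> carrier E \<Longrightarrow>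
          act (c \<otimes>\<^bsub>C\<^esub> d) x = act c (act d x)"
    and act_bounded: "\<exists>M. \<forall>c\<in>carrier C. \<forall>x\<in>carrier E.
          vnorm E (act c x) \<le> M * vnorm C c * vnorm E x"

definition bounded_operator ::
  "('k::real_normed_field, 'v) normed_struct \<Rightarrow> ('k, 'w) normed_struct \<Rightarrow> ('v \<Rightarrow> 'w) \<Rightarrow> bool" where
  "bounded_operator E F S \<longleftrightarrow>
     S \<in> carrier E \<rightarrow> carrier F \<and>
     (\<forall>x\<in>carrier E. \<forall>y\<in>carrier E. S (x \<oplus>\<^bsub>E\<^esub> y) = S x \<oplus>\<^bsub>F\<^esub> S y) \<and>
     (\<forall>r. \<forall>x\<in>carrier E. S (r \<odot>\<^bsub>E\<^esub> x) = r \<odot>\<^bsub>F\<^esub> S x) \<and>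
     (\<exists>M. \<forall>x\<in>carrier E. vnorm F (S x) \<le> M * vnorm E x)"

definition operator_norm ::
  "('k::real_normed_field, 'v) normed_struct \<Rightarrow> ('k, 'w) normed_struct \<Rightarrow> ('v \<Rightarrow> 'w) \<Rightarrow> real" where
  "operator_norm E F S = (SUP x\<in>{x \<in> carrier E. vnorm E x \<le> 1}. vnorm F (S x))"

(* The operator spaces B(E,F) and _C B(E,F); extensional makes equality of operators equality on
   the carrier. *)
definition bounded_operators ::
  "('k::real_normed_field, 'v) normed_struct \<Rightarrow> ('k, 'w) normed_struct \<Rightarrow> ('v \<Rightarrow> 'w) set" where
  "bounded_operators E F = {S \<in> extensional (carrier E). bounded_operator E F S}"

definition module_morphisms ::
  "('k::real_normed_field, 'c) normed_struct \<Rightarrow>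
   ('k, 'v) normed_struct \<Rightarrow> ('c \<Rightarrow> 'v \<Rightarrow> 'v) \<Rightarrow>
   ('k, 'w) normed_struct \<Rightarrow> ('c \<Rightarrow> 'w \<Rightarrow> 'w) \<Rightarrow> ('v \<Rightarrow> 'w) set" where
  "module_morphisms C E actE F actF =
     {S \<in> bounded_operators E F.
        \<forall>c\<in>carrier C. \<forall>x\<in>carrier E. S (actE c x) = actF c (S x)}"

definition admissible ::
  "('k::real_normed_field, 'v) normed_struct \<Rightarrow> ('k, 'w) normed_struct \<Rightarrow> ('v \<Rightarrow> 'w) \<Rightarrow> bool" where
  "admissible E F S \<longleftrightarrow> (\<exists>S'\<in>bounded_operators F E. \<forall>x\<in>carrier E. S (S' (S x)) = S x)"

(* HOL cannot quantify over types inside a formula, so the test modules E and F range over all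
   Banach left C-modules whose underlying set consists of elements of a type 'u, the universe.
   A theorem that leaves 'u free holds for every universe. *)
definition injective_left_module ::
  "'u itself \<Rightarrow> ('k::real_normed_field, 'c) normed_struct \<Rightarrow>
   ('k, 'v) normed_struct \<Rightarrow> ('c \<Rightarrow> 'v \<Rightarrow> 'v) \<Rightarrow> bool" where
  "injective_left_module U C K actK \<longleftrightarrow>
     banach_left_module C K actK \<and>
     (\<forall>(E :: ('k, 'u) normed_struct) actE (F :: ('k, 'u) normed_struct) actF S.
        banach_left_module C E actE \<longrightarrow> banach_left_module C F actF \<longrightarrow>
        S \<in> module_morphisms C E actE F actF \<longrightarrow> inj_on S (carrier E) \<longrightarrow> admissible E F S \<longrightarrow>
        (\<lambda>R. compose (carrier E) R S) ` module_morphisms C F actF K actK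
          = module_morphisms C E actE K actK)"

definition algebra_homomorphism ::
  "('k::real_normed_field, 'b) normed_struct \<Rightarrow> ('k, 'a) normed_struct \<Rightarrow> ('b \<Rightarrow> 'a) \<Rightarrow> bool" where
  "algebra_homomorphism B A T \<longleftrightarrow>
     T \<in> carrier B \<rightarrow> carrier A \<and>
     (\<forall>x\<in>carrier B. \<forall>y\<in>carrier B. T (x \<oplus>\<^bsub>B\<^esub> y) = T x \<oplus>\<^bsub>A\<^esub> T y) \<and>
     (\<forall>r. \<forall>x\<in>carrier B. T (r \<odot>\<^bsub>B\<^esub> x) = r \<odot>\<^bsub>A\<^esub> T x) \<and>
     (\<forall>x\<in>carrier B. \<forall>y\<in>carrier B. T (x \<otimes>\<^bsub>B\<^esub> y) = T x \<otimes>\<^bsub>A\<^esub> T y)"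

definition lau_product ::
  "('b \<Rightarrow> 'a) \<Rightarrow> ('k::real_normed_field, 'a) normed_struct \<Rightarrow> ('k, 'b) normed_struct \<Rightarrow>
   ('k, 'a \<times> 'b) normed_struct" where
  "lau_product T A B =
     \<lparr>carrier = carrier A \<times> carrier B,
      mult = (\<lambda>(a, b) (c, d).
        (a \<otimes>\<^bsub>A\<^esub> c \<oplus>\<^bsub>A\<^esub> T b \<otimes>\<^bsub>A\<^esub> c \<oplus>\<^bsub>A\<^esub> a \<otimes>\<^bsub>A\<^esub> T d, b \<otimes>\<^bsub>B\<^esub> d)),
      one = undefined,
      zero = (\<zero>\<^bsub>A\<^esub>, \<zero>\<^bsub>B\<^esub>),
      add = (\<lambda>(a, b) (c, d). (a \<oplus>\<^bsub>A\<^esub> c, b \<oplus>\<^bsub>B\<^esub> d)),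
      smult = (\<lambda>r (a, b). (r \<odot>\<^bsub>A\<^esub> a, r \<odot>\<^bsub>B\<^esub> b)),
      vnorm = (\<lambda>(a, b). vnorm A a + vnorm B b)\<rparr>"

end

theory Submission
  imports Defs
begin

text \<open>
  Injectivity of a module depends only on the Banach space and the action. As a Banach space the Lau
  product is the \<open>\<ell>\<^sup>1\<close>-direct sum of \<open>A\<close> and \<open>B\<close>, and additivity of the action on
  \<open>(a, b) = (a, 0) + (0, b)\<close> makes the action coordinatewise (\<open>lau_product_act\<close>). So the theorem is
  an instance of the fact that a finite product of injective modules is injective: a morphism into
  the product is a pair of morphisms into the factors (\<open>lau_product_fst_morphism\<close>,
  \<open>lau_product_snd_morphism\<close>, \<open>lau_product_pair_morphism\<close>), so each coordinate of a given morphism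
  can be extended separately and the two extensions recombined.
\<close>

lemma lau_product_simps:
  "carrier (lau_product T A B) = carrier A \<times> carrier B"
  "(a, b) \<oplus>\<^bsub>lau_product T A B\<^esub> (c, d) = (a \<oplus>\<^bsub>A\<^esub> c, b \<oplus>\<^bsub>B\<^esub> d)"
  "r \<odot>\<^bsub>lau_product T A B\<^esub> (a, b) = (r \<odot>\<^bsub>A\<^esub> a, r \<odot>\<^bsub>B\<^esub> b)"
  "vnorm (lau_product T A B) (a, b) = vnorm A a + vnorm B b"
  by (simp_all add: lau_product_def)

lemma lau_product_act:
  assumes A: "banach_space A" and B: "banach_space B"
    and L: "banach_left_module C (lau_product T A B) act"
    and actA: "\<And>c a. c \<in> carrier C \<Longrightarrow> a \<in> carrier A \<Longrightarrow> act c (a, \<zero>\<^bsub>B\<^esub>) = (actA c a, \<zero>\<^bsub>B\<^esub>)"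
    and actB: "\<And>c b. c \<in> carrier C \<Longrightarrow> b \<in> carrier B \<Longrightarrow> act c (\<zero>\<^bsub>A\<^esub>, b) = (\<zero>\<^bsub>A\<^esub>, actB c b)"
    and c: "c \<in> carrier C" and a: "a \<in> carrier A" and b: "b \<in> carrier B"
  shows "act c (a, b) = (actA c a, actB c b)"
proof -
  interpret A: banach_space A by (rule A)
  interpret B: banach_space B by (rule B)
  interpret L: banach_left_module C "lau_product T A B" act by (rule L)
  have "act c (a, \<zero>\<^bsub>B\<^esub>) \<in> carrier A \<times> carrier B" "act c (\<zero>\<^bsub>A\<^esub>, b) \<in> carrier A \<times> carrier B"
    using L.act_closed[OF c] a b by (auto simp: lau_product_simps)
  then have closed: "actA c a \<in> carrier A" "actB c b \<in> carrier B"
    using actA[OF c a] actB[OF c b] by auto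
  have "act c (a, b) = act c ((a, \<zero>\<^bsub>B\<^esub>) \<oplus>\<^bsub>lau_product T A B\<^esub> (\<zero>\<^bsub>A\<^esub>, b))"
    using a b by (simp add: lau_product_simps)
  also have "\<dots> = act c (a, \<zero>\<^bsub>B\<^esub>) \<oplus>\<^bsub>lau_product T A B\<^esub> act c (\<zero>\<^bsub>A\<^esub>, b)"
    by (rule L.act_add_right) (use a b c in \<open>auto simp: lau_product_simps\<close>)
  also have "\<dots> = (actA c a, actB c b)"
    using actA[OF c a] actB[OF c b] closed by (simp add: lau_product_simps)
  finally show ?thesis .
qed

lemma module_morphismsI:
  assumes "S \<in> extensional (carrier E)"
    and "\<And>x. x \<in> carrier E \<Longrightarrow> S x \<in> carrier F"
    and "\<And>x y. x \<in> carrier E \<Longrightarrow> y \<in> carrier E \<Longrightarrow> S (x \<oplus>\<^bsub>E\<^esub> y) = S x \<oplus>\<^bsub>F\<^esub> S y"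
    and "\<And>r x. x \<in> carrier E \<Longrightarrow> S (r \<odot>\<^bsub>E\<^esub> x) = r \<odot>\<^bsub>F\<^esub> S x"
    and "\<And>x. x \<in> carrier E \<Longrightarrow> vnorm F (S x) \<le> M * vnorm E x"
    and "\<And>c x. c \<in> carrier C \<Longrightarrow> x \<in> carrier E \<Longrightarrow> S (actE c x) = actF c (S x)"
  shows "S \<in> module_morphisms C E actE F actF"
  unfolding module_morphisms_def bounded_operators_def bounded_operator_def mem_Collect_eq
  by (intro conjI ballI allI exI[of _ M] funcsetI assms)

lemma module_morphismsD:
  assumes "S \<in> module_morphisms C E actE F actF"
  shows "S \<in> extensional (carrier E)"
    and "x \<in> carrier E \<Longrightarrow> S x \<in> carrier F"
    and "x \<in> carrier E \<Longrightarrow> y \<in> carrier E \<Longrightarrow> S (x \<oplus>\<^bsub>E\<^esub> y) = S x \<oplus>\<^bsub>F\<^esub> S y"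
    and "x \<in> carrier E \<Longrightarrow> S (r \<odot>\<^bsub>E\<^esub> x) = r \<odot>\<^bsub>F\<^esub> S x"
    and "\<exists>M. \<forall>x\<in>carrier E. vnorm F (S x) \<le> M * vnorm E x"
    and "c \<in> carrier C \<Longrightarrow> x \<in> carrier E \<Longrightarrow> S (actE c x) = actF c (S x)"
  using assms by (simp_all add: module_morphisms_def bounded_operators_def bounded_operator_def Pi_iff)

lemma banach_left_module_closed:
  assumes "banach_left_module C E actE" "x \<in> carrier E"
  shows "y \<in> carrier E \<Longrightarrow> x \<oplus>\<^bsub>E\<^esub> y \<in> carrier E"
    and "r \<odot>\<^bsub>E\<^esub> x \<in> carrier E"
    and "c \<in> carrier C \<Longrightarrow> actE c x \<in> carrier E"
    and "0 \<le> vnorm E x"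
proof -
  interpret E: banach_left_module C E actE by (rule assms)
  show "y \<in> carrier E \<Longrightarrow> x \<oplus>\<^bsub>E\<^esub> y \<in> carrier E"
    using assms(2) by (rule E.E.a_closed)
  show "r \<odot>\<^bsub>E\<^esub> x \<in> carrier E"
    using assms(2) by (intro E.E.smult_closed) (simp_all add: scalar_field_def)
  show "c \<in> carrier C \<Longrightarrow> actE c x \<in> carrier E"
    using assms(2) by (rule E.act_closed[rotated])
  show "0 \<le> vnorm E x"
    using assms(2) by (rule E.E.vnorm_nonneg)
qed

lemma compose_module_morphisms:
  assumes E: "banach_left_module C E actE" and F: "banach_left_module C F actF"
    and S: "S \<in> module_morphisms C E actE F actF"
    and R: "R \<in> module_morphisms C F actF G actG"
  shows "compose (carrier E) R S \<in> module_morphisms C E actE G actG"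
proof -
  obtain M where S_bound: "\<And>x. x \<in> carrier E \<Longrightarrow> vnorm F (S x) \<le> M * vnorm E x"
    using module_morphismsD(5)[OF S] by blast
  obtain N where R_bound: "\<And>x. x \<in> carrier F \<Longrightarrow> vnorm G (R x) \<le> N * vnorm F x"
    using module_morphismsD(5)[OF R] by blast
  note closed = banach_left_module_closed[OF E]
  have bound: "vnorm G (R (S x)) \<le> (\<bar>N\<bar> * M) * vnorm E x" if x: "x \<in> carrier E" for x
  proof -
    have "vnorm G (R (S x)) \<le> N * vnorm F (S x)"
      using R_bound module_morphismsD(2)[OF S] x by blast
    \<comment> \<open>The given bounds may be negative, as on the zero module, so the outer one is
      replaced by its absolute value before the inner estimate is inserted.\<close>
    also have "\<dots> \<le> \<bar>N\<bar> * vnorm F (S x)"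
      using banach_left_module_closed(4)[OF F] module_morphismsD(2)[OF S x] by (intro mult_right_mono) auto
    also have "\<dots> \<le> \<bar>N\<bar> * (M * vnorm E x)"
      using S_bound[OF x] by (intro mult_left_mono) auto
    finally show ?thesis by (simp add: mult.assoc)
  qed
  show ?thesis
    by (rule module_morphismsI[where M = "\<bar>N\<bar> * M"]) (use bound in \<open>auto simp: compose_def closed module_morphismsD[OF S] module_morphismsD[OF R]\<close>)
qed

lemma lau_product_fst_morphism:
  assumes A: "banach_left_module C A actA" and B: "banach_left_module C B actB"
    and act: "\<And>c a b. c \<in> carrier C \<Longrightarrow> a \<in> carrier A \<Longrightarrow> b \<in> carrier B \<Longrightarrow>
      act c (a, b) = (actA c a, actB c b)"
  shows "restrict fst (carrier A \<times> carrier B)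
    \<in> module_morphisms C (lau_product T A B) act A actA"
  by (rule module_morphismsI[where M = 1])
    (auto simp: lau_product_simps act banach_left_module_closed[OF A] banach_left_module_closed[OF B])

lemma lau_product_snd_morphism:
  assumes A: "banach_left_module C A actA" and B: "banach_left_module C B actB"
    and act: "\<And>c a b. c \<in> carrier C \<Longrightarrow> a \<in> carrier A \<Longrightarrow> b \<in> carrier B \<Longrightarrow>
      act c (a, b) = (actA c a, actB c b)"
  shows "restrict snd (carrier A \<times> carrier B)
    \<in> module_morphisms C (lau_product T A B) act B actB"
  by (rule module_morphismsI[where M = 1])
    (auto simp: lau_product_simps act banach_left_module_closed[OF A] banach_left_module_closed[OF B])

text \<open>
  The norm of the product is the sum of the coordinate norms, so the bounds of the two
  coordinate morphisms add up to one of the paired morphism.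
\<close>
lemma lau_product_pair_morphism:
  assumes F: "banach_left_module C F actF"
    and act: "\<And>c a b. c \<in> carrier C \<Longrightarrow> a \<in> carrier A \<Longrightarrow> b \<in> carrier B \<Longrightarrow>
      act c (a, b) = (actA c a, actB c b)"
    and P: "P \<in> module_morphisms C F actF A actA"
    and Q: "Q \<in> module_morphisms C F actF B actB"
  shows "(\<lambda>y\<in>carrier F. (P y, Q y)) \<in> module_morphisms C F actF (lau_product T A B) act"
proof -
  obtain M where P_bound: "\<And>x. x \<in> carrier F \<Longrightarrow> vnorm A (P x) \<le> M * vnorm F x"
    using module_morphismsD(5)[OF P] by blast
  obtain N where Q_bound: "\<And>x. x \<in> carrier F \<Longrightarrow> vnorm B (Q x) \<le> N * vnorm F x"
    using module_morphismsD(5)[OF Q] by blast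
  have bound: "vnorm A (P x) + vnorm B (Q x) \<le> (M + N) * vnorm F x" if "x \<in> carrier F" for x
    using P_bound[OF that] Q_bound[OF that] by (simp add: distrib_right)
  show ?thesis
    by (rule module_morphismsI[where M = "M + N"])
      (use bound in \<open>auto simp: lau_product_simps act banach_left_module_closed[OF F]
          module_morphismsD[OF P] module_morphismsD[OF Q]\<close>)
qed

lemma injective_left_module_extend:
  fixes E F :: "('k::real_normed_field, 'u) normed_struct"
  assumes "injective_left_module TYPE('u) C K actK"
    and "banach_left_module C E actE" "banach_left_module C F actF"
    and "S \<in> module_morphisms C E actE F actF" "inj_on S (carrier E)" "admissible E F S"
    and "Q \<in> module_morphisms C E actE K actK"
  shows "\<exists>R\<in>module_morphisms C F actF K actK. \<forall>x\<in>carrier E. R (S x) = Q x"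
proof -
  have "Q \<in> (\<lambda>R. compose (carrier E) R S) ` module_morphisms C F actF K actK"
    using assms unfolding injective_left_module_def by blast
  then obtain R where "R \<in> module_morphisms C F actF K actK" "Q = compose (carrier E) R S"
    by blast
  then show ?thesis
    by (auto simp: compose_eq)
qed

theorem theorem2p5:
  fixes A :: "('k::real_normed_field, 'a) normed_struct"
    and B :: "('k, 'b) normed_struct"
    and C :: "('k, 'c) normed_struct"
    and T :: "'b \<Rightarrow> 'a"
    and act :: "'c \<Rightarrow> 'a \<times> 'b \<Rightarrow> 'a \<times> 'b"
    and actA :: "'c \<Rightarrow> 'a \<Rightarrow> 'a"
    and actB :: "'c \<Rightarrow> 'b \<Rightarrow> 'b"
  assumes "banach_algebra A"
    and "banach_algebra B"
    and "algebra_homomorphism B A T"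
    and "bounded_operator B A T"
    and "operator_norm B A T \<le> 1"
    and "banach_algebra C"
    and "banach_left_module C (lau_product T A B) act"
    and "\<And>c a. c \<in> carrier C \<Longrightarrow> a \<in> carrier A \<Longrightarrow> act c (a, \<zero>\<^bsub>B\<^esub>) = (actA c a, \<zero>\<^bsub>B\<^esub>)"
    and "\<And>c b. c \<in> carrier C \<Longrightarrow> b \<in> carrier B \<Longrightarrow> act c (\<zero>\<^bsub>A\<^esub>, b) = (\<zero>\<^bsub>A\<^esub>, actB c b)"
    and "injective_left_module TYPE('u) C A actA"
    and "injective_left_module TYPE('u) C B actB"
  shows "injective_left_module TYPE('u) C (lau_product T A B) act"
proof -
  let ?L = "lau_product T A B"
  have A: "banach_left_module C A actA" and B: "banach_left_module C B actB"
    using assms(10,11) unfolding injective_left_module_def by blast+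
  have spaces: "banach_space A" "banach_space B"
    using assms(1,2) by (simp_all add: banach_algebra_def)
  have act: "act c (a, b) = (actA c a, actB c b)"
    if "c \<in> carrier C" "a \<in> carrier A" "b \<in> carrier B" for c a b
    by (rule lau_product_act[OF spaces assms(7-9) that])
  have extend: "Q \<in> (\<lambda>R. compose (carrier E) R S) ` module_morphisms C F actF ?L act"
    if E: "banach_left_module C E actE" and F: "banach_left_module C F actF"
      and S: "S \<in> module_morphisms C E actE F actF" "inj_on S (carrier E)" "admissible E F S"
      and Q: "Q \<in> module_morphisms C E actE ?L act"
    for E F :: "('k, 'u) normed_struct" and actE actF S Q
  proof -
    have Q_carrier: "Q x \<in> carrier A \<times> carrier B" if "x \<in> carrier E" for x
      using module_morphismsD(2)[OF Q that] by (simp only: lau_product_simps(1))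
    have Q_ext: "Q \<in> extensional (carrier E)"
      by (rule module_morphismsD(1)[OF Q])
    obtain P where P: "P \<in> module_morphisms C F actF A actA"
      "\<And>x. x \<in> carrier E \<Longrightarrow>
        P (S x) = compose (carrier E) (restrict fst (carrier A \<times> carrier B)) Q x"
      using injective_left_module_extend[OF assms(10) E F S
          compose_module_morphisms[OF E assms(7) Q lau_product_fst_morphism[OF A B act]]]
      by blast
    obtain R where R: "R \<in> module_morphisms C F actF B actB"
      "\<And>x. x \<in> carrier E \<Longrightarrow>
        R (S x) = compose (carrier E) (restrict snd (carrier A \<times> carrier B)) Q x"
      using injective_left_module_extend[OF assms(11) E F S
          compose_module_morphisms[OF E assms(7) Q lau_product_snd_morphism[OF A B act]]]
      by blast
    have S_carrier: "S x \<in> carrier F" if "x \<in> carrier E" for x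
      by (rule module_morphismsD(2)[OF S(1) that])
    have "Q = compose (carrier E) (\<lambda>y\<in>carrier F. (P y, R y)) S"
      by (rule extensionalityI[OF Q_ext compose_extensional])
        (simp add: compose_eq S_carrier P(2) R(2) Q_carrier)
    then show ?thesis
      using lau_product_pair_morphism[OF F act P(1) R(1)] by (intro image_eqI)
  qed
  show ?thesis
    unfolding injective_left_module_def
  proof (intro conjI allI impI equalityI image_subsetI subsetI)
    show "banach_left_module C ?L act"
      by (rule assms(7))
  qed (rule compose_module_morphisms extend; assumption)+
qed

end
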